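(* Let $\mathcal{L}=(L,\wedge,\vee,\otimes,0,1)$ be an integral $\ell$-monoid, let $\alpha$ be an arbitrary fuzzy regular expression over a finite alphabet $X$, and let $\mathcal A^{\rm r}_{\rm pf}(\alpha)$ and $\mathcal A^{\rm r}_{\rm ff}(\alpha)$ be respectively the position fuzzy automaton and the follow fuzzy automaton of $\alpha$. Then there is a right invariant crisp equivalence $F$ on $\mathcal A^{\rm r}_{\rm pf}(\alpha)$ such that $\mathcal A^{\rm r}_{\rm ff}(\alpha)$ is isomorphic to the factor fuzzy automaton $\mathcal A^{\rm r}_{\rm pf}(\alpha)/F$.
   Context: **Integral $\ell$-monoid.** An algebra $(L,\wedge,\vee,\otimes,0,1)$ such that $(L,\wedge,\vee,0,1)$ is a lattice with least element $0$ and greatest element $1$ (not necessarily complete), $(L,\otimes,1)$ is a (not necessarily commutative) monoid whose unit is the greatest element $1$, $x\otimes 0=0\otimes x=0$, $x\otimes(y\vee z)=(x\otimes y)\vee(x\otimes z)$ and $(x\vee y)\otimes z=(x\otimes z)\vee(y\otimes z)$ for all $x,y,z\in L$. **Fuzzy regular expressions** over a finite alphabet $X$ are defined inductively: $\emptyset$, $\varepsilon$ (empty word) and each $x\in X$ are fuzzy regular expressions; if $\alpha,\alpha_1,\alpha_2$ are, then so are $(\lambda\alpha)$ for $\lambda\in L$, $(\alpha_1+\alpha_2)$, $(\alpha_1\alpha_2)$ and $(\alpha^* )$. A regular expression is a fuzzy regular expression without scalars; its language $\|\cdot\|$ is the usual one. **The regular expression $\alpha_R$.** Let $K\subseteq L$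 be the (finite, possibly empty) set of scalars appearing in $\alpha$. An alphabet associated with $\alpha$ is a set $Y$ with $Y\cap X=\emptyset$ together with a bijection $K\to Y$, $\lambda\mapsto\lambda'$ (fixed). Then $\alpha_R$ is the regular expression over $X\cup Y$ obtained from $\alpha$ by replacing each scalar $\lambda$ by the letter $\lambda'$ (so scalar multiplication by $\lambda$ becomes concatenation with $\lambda'$ on the left). **Fuzzy relations.** A fuzzy relation on $A$ is a map $A\times A\to L$, ordered pointwise; $(R\circ S)(a,b)=\bigvee_{c\in A}R(a,c)\otimes S(c,b)$ and, for $f:A\to L$, $(R\circ f)(a)=\bigvee_{b\in A}R(a,b)\otimes f(b)$. $R$ is transitive if $R(a,b)\otimes R(b,c)\le R(a,c)$ for all $a,b,c$. Crisp equivalences are identified with their $\{0,1\}$-valued characteristic functions; $E_a$ denotes the class of $a$. **Automata.** A fuzzy automaton with a single crisp initial state is $\mathcal B=(B,Z,\delta^B,b_0,\tau^B)$ with $B$ a finite nonempty set, $Z$ a finite alphabet, $\delta^B:B\times Z\times B\to L$, $b_0\in B$, $\tau^B:B\to L$; write $\delta^B_x(a,b)=\delta^B(a,x,b)$. It is a nondeterministic automaton if $\delta^B,\tau^B$ take values in $\{0,1\}$. A right invariant crisp equivalence on $\mathcal B$ is an equivalence $E$ on $B$ with $E\circ\delta^B_x\le\delta^B_x\circ E$ for all $x\in Z$ and $E\circ\tau^B=\tau^B$. For a crisp equivalence $E$ on $B$, the factor fuzzy automaton $\mathcal B/E$ has states $B/E$, initial state $E_{b_0}$, $\delta^{B/E}(E_a,x,E_b)=(E\circ\delta^B_x\circ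 E)(a,b)$ and $\tau^{B/E}(E_a)=\bigvee_{a'\in B}\tau^B(a')\otimes E(a',a)$. An isomorphism of fuzzy automata is a bijection between state sets preserving the initial state, all transition degrees and the terminal degrees. **Reduced fuzzy automaton.** For a nondeterministic automaton $\mathcal A=(A,X\cup Y,\delta^A,a_0,\tau^A)$, let $R$ be the fuzzy relation on $A$ with $R(a,a)=1$ and $R(a,b)=\bigvee_{\lambda'\in Y}\lambda\otimes\delta^A(a,\lambda',b)$ for $a\ne b$, and let $R_{\mathcal A}$ be the least transitive fuzzy relation containing $R$ (it equals $R^n$, $n=|A|$). The reduced fuzzy automaton associated with $\mathcal A$ and $\alpha$ is $\mathcal A^{\rm r}_\alpha=(A^{\rm r}_\alpha,X,\delta^{A^{\rm r}_\alpha},a_0,\tau^{A^{\rm r}_\alpha})$ with $A^{\rm r}_\alpha=\{a_0\}\cup\{a\in A\mid(\exists b\in A)(\exists x\in X)\ \delta^A(b,x,a)=1\}$, $\delta^{A^{\rm r}_\alpha}_x(a,b)=(R_{\mathcal A}\circ\delta^A_x)(a,b)$ and $\tau^{A^{\rm r}_\alpha}(a)=(R_{\mathcal A}\circ\tau^A)(a)$. **Position and follow automata.** For a regular expression $\beta$ over an alphabet $Z$, with $m$ occurrences of letters, let $\overline\beta$ be obtained by marking each letter occurrence with its position $1,\dots,m$ (so the $i$-th occurrence, of letter $z$, becomes a new letter $x_i$ with $\overline{x_i}=z$). Put $pos_0(\beta)=\{0,1,\dots,m\}$, $first(\beta)=\{i\mid x_iu\in\|\overline\beta\|\text{ for some }u\}$,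 $last(\beta)=\{i\mid ux_i\in\|\overline\beta\|\text{ for some }u\}$, $follow(\beta,i)=\{j\mid ux_ix_jv\in\|\overline\beta\|\text{ for some }u,v\}$ for $i\ge1$, $follow(\beta,0)=first(\beta)$, and $last_0(\beta)=last(\beta)$ if $\varepsilon\notin\|\beta\|$, $last_0(\beta)=last(\beta)\cup\{0\}$ otherwise. The position automaton $\mathcal A_{\rm p}(\beta)$ is the nondeterministic automaton with states $pos_0(\beta)$, alphabet $Z$, initial state $0$, set of terminal states $last_0(\beta)$, and a transition $(i,z,j)$ iff $\overline{x_j}=z$ and $j\in follow(\beta,i)$. The follow equivalence on $\mathcal A_{\rm p}(\beta)$ is: $i\equiv_f j$ iff ($i\in last_0(\beta)\Leftrightarrow j\in last_0(\beta)$) and $follow(\beta,i)=follow(\beta,j)$; it is a right invariant equivalence on $\mathcal A_{\rm p}(\beta)$. The follow automaton $\mathcal A_{\rm f}(\beta)$ is the factor automaton $\mathcal A_{\rm p}(\beta)/{\equiv_f}$. **Position and follow fuzzy automata of $\alpha$.** $\mathcal A^{\rm r}_{\rm pf}(\alpha)$ is the reduced fuzzy automaton associated with $\mathcal A_{\rm p}(\alpha_R)$ and $\alpha$; $\mathcal A^{\rm r}_{\rm ff}(\alpha)$ is the reduced fuzzy automaton associated with $\mathcal A_{\rm f}(\alpha_R)$ and $\alpha$. *)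

theory Defs
  imports Main
begin

text \<open>Integral lattice-ordered monoids; the lattice is not assumed complete, and
  \<open>0 = 1\<close> is not excluded.\<close>

class integral_l_monoid = bounded_lattice + monoid_mult + mult_zero +
  assumes bot_eq_zero: "bot = 0"
    and top_eq_one: "top = 1"
    and mult_sup_distrib: "x * sup y z = sup (x * y) (x * z)"
    and sup_mult_distrib: "sup x y * z = sup (x * z) (y * z)"


section \<open>Regular and fuzzy regular expressions\<close>

text \<open>The set functions \<open>scalars\<close> and \<open>letters\<close> collect the scalars and the letters
  occurring in an expression.\<close>

datatype (scalars: 'l, letters: 'x) fregexp =
    FEmpty
  | FEps
  | FLetter 'x
  | FScalar 'l "('l, 'x) fregexp"
  | FPlus "('l, 'x) fregexp" "('l, 'x) fregexp"
  | FTimes "('l, 'x) fregexp" "('l, 'x) fregexp"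
  | FStar "('l, 'x) fregexp"

datatype 'z regexp =
    Empty
  | Eps
  | Letter 'z
  | Plus "'z regexp" "'z regexp"
  | Times "'z regexp" "'z regexp"
  | Star "'z regexp"

primrec lang :: "'z regexp \<Rightarrow> 'z list set" where
  "lang Empty = {}"
| "lang Eps = {[]}"
| "lang (Letter z) = {[z]}"
| "lang (Plus \<beta> \<gamma>) = lang \<beta> \<union> lang \<gamma>"
| "lang (Times \<beta> \<gamma>) = {u @ v | u v. u \<in> lang \<beta> \<and> v \<in> lang \<gamma>}"
| "lang (Star \<beta>) = {concat us | us. set us \<subseteq> lang \<beta>}"

text \<open>An alphabet associated with \<open>\<alpha>\<close> (over \<open>X\<close>): both \<open>X\<close> and \<open>Y\<close> live in one type of
  letters, and \<open>pr \<lambda>\<close> is the letter \<open>\<lambda>'\<close>.\<close>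

definition associated_alphabet ::
    "'x set \<Rightarrow> ('l, 'x) fregexp \<Rightarrow> 'x set \<Rightarrow> ('l \<Rightarrow> 'x) \<Rightarrow> bool" where
  "associated_alphabet X \<alpha> Y pr \<longleftrightarrow> Y \<inter> X = {} \<and> bij_betw pr (scalars \<alpha>) Y"

primrec to_regexp :: "('l \<Rightarrow> 'x) \<Rightarrow> ('l, 'x) fregexp \<Rightarrow> 'x regexp" where
  "to_regexp pr FEmpty = Empty"
| "to_regexp pr FEps = Eps"
| "to_regexp pr (FLetter x) = Letter x"
| "to_regexp pr (FScalar l \<alpha>) = Times (Letter (pr l)) (to_regexp pr \<alpha>)"
| "to_regexp pr (FPlus \<alpha> \<beta>) = Plus (to_regexp pr \<alpha>) (to_regexp pr \<beta>)"
| "to_regexp pr (FTimes \<alpha> \<beta>) = Times (to_regexp pr \<alpha>) (to_regexp pr \<beta>)"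
| "to_regexp pr (FStar \<alpha>) = Star (to_regexp pr \<alpha>)"


section \<open>Fuzzy relations on a finite set\<close>

definition join :: "'a set \<Rightarrow> ('a \<Rightarrow> 'l::integral_l_monoid) \<Rightarrow> 'l" where
  "join A f = Sup_fin (insert 0 (f ` A))"

definition crisp :: "('s \<times> 's) set \<Rightarrow> 's \<Rightarrow> 's \<Rightarrow> 'l::integral_l_monoid" where
  "crisp E a b = (if (a, b) \<in> E then 1 else 0)"

definition rcomp ::
    "'s set \<Rightarrow> ('s \<Rightarrow> 's \<Rightarrow> 'l::integral_l_monoid) \<Rightarrow> ('s \<Rightarrow> 's \<Rightarrow> 'l) \<Rightarrow> 's \<Rightarrow> 's \<Rightarrow> 'l" where
  "rcomp A R S a b = join A (\<lambda>c. R a c * S c b)"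

definition rapp ::
    "'s set \<Rightarrow> ('s \<Rightarrow> 's \<Rightarrow> 'l::integral_l_monoid) \<Rightarrow> ('s \<Rightarrow> 'l) \<Rightarrow> 's \<Rightarrow> 'l" where
  "rapp A R f a = join A (\<lambda>b. R a b * f b)"

definition transitive_frel :: "'s set \<Rightarrow> ('s \<Rightarrow> 's \<Rightarrow> 'l::integral_l_monoid) \<Rightarrow> bool" where
  "transitive_frel A R \<longleftrightarrow> (\<forall>a\<in>A. \<forall>b\<in>A. \<forall>c\<in>A. R a b * R b c \<le> R a c)"

text \<open>The least transitive fuzzy relation on \<open>A\<close> containing \<open>R\<close>. The conditions only concern
  pairs in \<open>A \<times> A\<close>, so the least solution in the pointwise order on total functions is \<open>0\<close>
  elsewhere.\<close>

definition transitive_hull ::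
    "'s set \<Rightarrow> ('s \<Rightarrow> 's \<Rightarrow> 'l::integral_l_monoid) \<Rightarrow> 's \<Rightarrow> 's \<Rightarrow> 'l" where
  "transitive_hull A R =
     (LEAST Q. transitive_frel A Q \<and> (\<forall>a\<in>A. \<forall>b\<in>A. R a b \<le> Q a b))"


section \<open>Fuzzy automata\<close>

text \<open>\<open>tdeg M a x b\<close> and \<open>final M a\<close> are meaningful only for states \<open>a\<close>, \<open>b\<close> in \<open>states M\<close>
  and letters \<open>x\<close> in \<open>alphabet M\<close>.\<close>

record ('s, 'z, 'l) fuzzy_automaton =
  states :: "'s set"
  alphabet :: "'z set"
  tdeg :: "'s \<Rightarrow> 'z \<Rightarrow> 's \<Rightarrow> 'l"
  init :: 's
  final :: "'s \<Rightarrow> 'l"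

definition right_invariant ::
    "('s, 'z, 'l::integral_l_monoid) fuzzy_automaton \<Rightarrow> ('s \<times> 's) set \<Rightarrow> bool" where
  "right_invariant M E \<longleftrightarrow>
     equiv (states M) E \<and>
     (\<forall>x\<in>alphabet M. \<forall>a\<in>states M. \<forall>b\<in>states M.
        rcomp (states M) (crisp E) (\<lambda>c d. tdeg M c x d) a b
          \<le> rcomp (states M) (\<lambda>c d. tdeg M c x d) (crisp E) a b) \<and>
     (\<forall>a\<in>states M. rapp (states M) (crisp E) (final M) a = final M a)"

text \<open>The degrees of a factor automaton are defined through representatives; \<open>the_elem\<close>
  extracts the common value over all of them (see \<open>tdeg_factor\<close> and \<open>final_factor\<close> below).\<close>

definition factor ::
    "('s, 'z, 'l::integral_l_monoid) fuzzy_automaton \<Rightarrow> ('s \<times> 's) set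
      \<Rightarrow> ('s set, 'z, 'l) fuzzy_automaton" where
  "factor M E = \<lparr>
     states = states M // E,
     alphabet = alphabet M,
     tdeg = (\<lambda>P x Q. the_elem
       ((\<lambda>(a, b). rcomp (states M) (rcomp (states M) (crisp E) (\<lambda>c d. tdeg M c x d)) (crisp E) a b)
         ` (P \<times> Q))),
     init = E `` {init M},
     final = (\<lambda>P. the_elem ((\<lambda>a. join (states M) (\<lambda>a'. final M a' * crisp E a' a)) ` P)) \<rparr>"

definition isomorphic ::
    "('s, 'z, 'l) fuzzy_automaton \<Rightarrow> ('t, 'z, 'l) fuzzy_automaton \<Rightarrow> bool" where
  "isomorphic M N \<longleftrightarrow>
     alphabet M = alphabet N \<and>
     (\<exists>\<phi>. bij_betw \<phi> (states M) (states N) \<and>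
        \<phi> (init M) = init N \<and>
        (\<forall>a\<in>states M. \<forall>x\<in>alphabet M. \<forall>b\<in>states M. tdeg N (\<phi> a) x (\<phi> b) = tdeg M a x b) \<and>
        (\<forall>a\<in>states M. final N (\<phi> a) = final M a))"


section \<open>The reduced fuzzy automaton\<close>

text \<open>Here \<open>K\<close> is the set of scalars, \<open>pr\<close> maps \<open>\<lambda>\<close> to \<open>\<lambda>'\<close>, and the alphabet of \<open>M\<close> is meant
  to be \<open>X \<union> pr ` K\<close>; the join over \<open>\<lambda>' \<in> Y\<close> is indexed by \<open>\<lambda> \<in> K\<close>.\<close>

definition scalar_frel ::
    "'l set \<Rightarrow> ('l \<Rightarrow> 'z) \<Rightarrow> ('s, 'z, 'l::integral_l_monoid) fuzzy_automaton \<Rightarrow> 's \<Rightarrow> 's \<Rightarrow> 'l" where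
  "scalar_frel K pr M a b = (if a = b then 1 else join K (\<lambda>l. l * tdeg M a (pr l) b))"

definition scalar_hull ::
    "'l set \<Rightarrow> ('l \<Rightarrow> 'z) \<Rightarrow> ('s, 'z, 'l::integral_l_monoid) fuzzy_automaton \<Rightarrow> 's \<Rightarrow> 's \<Rightarrow> 'l" where
  "scalar_hull K pr M = transitive_hull (states M) (scalar_frel K pr M)"

definition reduced ::
    "'z set \<Rightarrow> 'l set \<Rightarrow> ('l \<Rightarrow> 'z) \<Rightarrow> ('s, 'z, 'l::integral_l_monoid) fuzzy_automaton
      \<Rightarrow> ('s, 'z, 'l) fuzzy_automaton" where
  "reduced X K pr M = \<lparr>
     states = {init M} \<union> {a \<in> states M. \<exists>b\<in>states M. \<exists>x\<in>X. tdeg M b x a = 1},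
     alphabet = X,
     tdeg = (\<lambda>a x b. rcomp (states M) (scalar_hull K pr M) (\<lambda>c d. tdeg M c x d) a b),
     init = init M,
     final = (\<lambda>a. rapp (states M) (scalar_hull K pr M) (final M) a) \<rparr>"


section \<open>Position and follow automata\<close>

primrec occs :: "'z regexp \<Rightarrow> 'z list" where
  "occs Empty = []"
| "occs Eps = []"
| "occs (Letter z) = [z]"
| "occs (Plus \<beta> \<gamma>) = occs \<beta> @ occs \<gamma>"
| "occs (Times \<beta> \<gamma>) = occs \<beta> @ occs \<gamma>"
| "occs (Star \<beta>) = occs \<beta>"

text \<open>The marked letter \<open>x\<^sub>i\<close> is represented by the number \<open>i\<close> itself; \<open>letter_at \<beta> i\<close>
  recovers the underlying letter. The first argument of \<open>mark_from\<close> is the number of letter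
  occurrences to the left of the expression.\<close>

primrec mark_from :: "nat \<Rightarrow> 'z regexp \<Rightarrow> nat regexp" where
  "mark_from k Empty = Empty"
| "mark_from k Eps = Eps"
| "mark_from k (Letter z) = Letter (Suc k)"
| "mark_from k (Plus \<beta> \<gamma>) = Plus (mark_from k \<beta>) (mark_from (k + length (occs \<beta>)) \<gamma>)"
| "mark_from k (Times \<beta> \<gamma>) = Times (mark_from k \<beta>) (mark_from (k + length (occs \<beta>)) \<gamma>)"
| "mark_from k (Star \<beta>) = Star (mark_from k \<beta>)"

definition marked :: "'z regexp \<Rightarrow> nat regexp" where
  "marked \<beta> = mark_from 0 \<beta>"

definition letter_at :: "'z regexp \<Rightarrow> nat \<Rightarrow> 'z" where
  "letter_at \<beta> i = occs \<beta> ! (i - 1)"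

definition pos0 :: "'z regexp \<Rightarrow> nat set" where
  "pos0 \<beta> = {0..length (occs \<beta>)}"

definition first_pos :: "'z regexp \<Rightarrow> nat set" where
  "first_pos \<beta> = {i. \<exists>u. i # u \<in> lang (marked \<beta>)}"

definition last_pos :: "'z regexp \<Rightarrow> nat set" where
  "last_pos \<beta> = {i. \<exists>u. u @ [i] \<in> lang (marked \<beta>)}"

definition follow_pos :: "'z regexp \<Rightarrow> nat \<Rightarrow> nat set" where
  "follow_pos \<beta> i =
     (if i = 0 then first_pos \<beta> else {j. \<exists>u v. u @ [i, j] @ v \<in> lang (marked \<beta>)})"

definition last0_pos :: "'z regexp \<Rightarrow> nat set" where
  "last0_pos \<beta> = (if [] \<in> lang \<beta> then last_pos \<beta> \<union> {0} else last_pos \<beta>)"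

definition position_automaton ::
    "'z set \<Rightarrow> 'z regexp \<Rightarrow> (nat, 'z, 'l::integral_l_monoid) fuzzy_automaton" where
  "position_automaton Z \<beta> = \<lparr>
     states = pos0 \<beta>,
     alphabet = Z,
     tdeg = (\<lambda>i z j. if letter_at \<beta> j = z \<and> j \<in> follow_pos \<beta> i then 1 else 0),
     init = 0,
     final = (\<lambda>i. if i \<in> last0_pos \<beta> then 1 else 0) \<rparr>"

definition follow_equiv :: "'z regexp \<Rightarrow> (nat \<times> nat) set" where
  "follow_equiv \<beta> =
     {(i, j). i \<in> pos0 \<beta> \<and> j \<in> pos0 \<beta> \<and>
        (i \<in> last0_pos \<beta> \<longleftrightarrow> j \<in> last0_pos \<beta>) \<and> follow_pos \<beta> i = follow_pos \<beta> j}"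

definition follow_automaton ::
    "'z set \<Rightarrow> 'z regexp \<Rightarrow> (nat set, 'z, 'l::integral_l_monoid) fuzzy_automaton" where
  "follow_automaton Z \<beta> = factor (position_automaton Z \<beta>) (follow_equiv \<beta>)"

definition position_fuzzy_automaton ::
    "'x set \<Rightarrow> 'x set \<Rightarrow> ('l \<Rightarrow> 'x) \<Rightarrow> ('l::integral_l_monoid, 'x) fregexp
      \<Rightarrow> (nat, 'x, 'l) fuzzy_automaton" where
  "position_fuzzy_automaton X Y pr \<alpha> =
     reduced X (scalars \<alpha>) pr (position_automaton (X \<union> Y) (to_regexp pr \<alpha>))"

definition follow_fuzzy_automaton ::
    "'x set \<Rightarrow> 'x set \<Rightarrow> ('l \<Rightarrow> 'x) \<Rightarrow> ('l::integral_l_monoid, 'x) fregexp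
      \<Rightarrow> (nat set, 'x, 'l) fuzzy_automaton" where
  "follow_fuzzy_automaton X Y pr \<alpha> =
     reduced X (scalars \<alpha>) pr (follow_automaton (X \<union> Y) (to_regexp pr \<alpha>))"


section \<open>Factor automata are well defined\<close>

lemma crisp_cong:
  assumes "equiv A E" "(a, b) \<in> E"
  shows "crisp E a c = crisp E b c" "crisp E c a = crisp E c b"
proof -
  have "sym E" "trans E"
    using assms(1) by (auto elim: equivE)
  then have "(a, c) \<in> E \<longleftrightarrow> (b, c) \<in> E" "(c, a) \<in> E \<longleftrightarrow> (c, b) \<in> E"
    using assms(2) by (meson symD transD)+
  then show "crisp E a c = crisp E b c" "crisp E c a = crisp E c b"
    by (simp_all add: crisp_def)
qed

lemma the_elem_const_image:
  assumes "P \<noteq> {}" "\<And>p. p \<in> P \<Longrightarrow> f p = c"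
  shows "the_elem (f ` P) = c"
proof -
  have "f ` P = {c}"
    using assms by force
  then show ?thesis
    by simp
qed

lemma tdeg_factor:
  assumes E: "equiv (states M) E" and ab: "a \<in> states M" "b \<in> states M"
  shows "tdeg (factor M E) (E `` {a}) x (E `` {b}) =
    rcomp (states M) (rcomp (states M) (crisp E) (\<lambda>c d. tdeg M c x d)) (crisp E) a b"
proof -
  have ne: "E `` {a} \<times> E `` {b} \<noteq> {}"
    using equiv_class_self[OF E ab(1)] equiv_class_self[OF E ab(2)] by blast
  have "rcomp (states M) (rcomp (states M) (crisp E) (\<lambda>c d. tdeg M c x d)) (crisp E) a' b' =
      rcomp (states M) (rcomp (states M) (crisp E) (\<lambda>c d. tdeg M c x d)) (crisp E) a b"
    if "(a, a') \<in> E" "(b, b') \<in> E" for a' b'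
    by (simp add: rcomp_def crisp_cong(1)[OF E that(1)] crisp_cong(2)[OF E that(2)])
  then show ?thesis
    unfolding factor_def by (simp, intro the_elem_const_image[OF ne]) auto
qed

lemma final_factor:
  assumes E: "equiv (states M) E" and a: "a \<in> states M"
  shows "final (factor M E) (E `` {a}) = join (states M) (\<lambda>a'. final M a' * crisp E a' a)"
proof -
  have ne: "E `` {a} \<noteq> {}"
    using equiv_class_self[OF E a] by blast
  show ?thesis
    unfolding factor_def
    by (simp, intro the_elem_const_image[OF ne]) (simp add: crisp_cong(2)[OF E])
qed

end

theory Submission
  imports Defs
begin

text \<open>Follow-equivalent positions have identical outgoing transitions and equal terminal
  degrees. For a function \<open>f\<close> on states, \<open>R\<^sub>\<A> \<circ> f\<close> is the least \<open>h \<ge> f\<close> with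
  \<open>R \<circ> h \<le> h\<close>; this universal property, which avoids residuals and complete joins, comes from
  computing the transitive hull by Warshall's algorithm (loops contribute at most \<open>1\<close>, the
  greatest element). It shows that \<open>R\<^sub>\<A> \<circ> f\<close> is constant on follow classes whenever \<open>f\<close> is,
  and that forming it commutes with passing to the factor automaton. Hence the restriction
  of the follow equivalence to the states of the reduced automaton is the required \<open>F\<close>.\<close>

section \<open>Finite joins in integral lattice-ordered monoids\<close>

lemma zero_least [simp]: "(0::'l::integral_l_monoid) \<le> x"
  by (metis bot_eq_zero bot_least)

lemma one_greatest [simp]: "x \<le> (1::'l::integral_l_monoid)"
  by (metis top_eq_one top_greatest)

lemma l_mult_mono:
  fixes x y u v :: "'l::integral_l_monoid"
  assumes "x \<le> y" "u \<le> v"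
  shows "x * u \<le> y * v"
proof -
  have "x * u \<le> y * u"
    by (metis assms(1) le_iff_sup sup_mult_distrib)
  also have "\<dots> \<le> y * v"
    by (metis assms(2) le_iff_sup mult_sup_distrib)
  finally show ?thesis .
qed

lemma l_mult_le:
  fixes x y :: "'l::integral_l_monoid"
  shows "x * y \<le> x" "x * y \<le> y"
  using l_mult_mono[of x x y 1] l_mult_mono[of x 1 y y] by simp_all

lemma join_le_iff: "finite A \<Longrightarrow> join A f \<le> u \<longleftrightarrow> (\<forall>a\<in>A. f a \<le> u)"
  by (simp add: join_def Sup_fin.bounded_iff)

lemma join_upper: "finite A \<Longrightarrow> a \<in> A \<Longrightarrow> f a \<le> join A f"
  using join_le_iff[of A f "join A f"] by simp

lemma join_empty [simp]: "join {} f = 0"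
  by (simp add: join_def)

lemma join_insert: "finite A \<Longrightarrow> join (insert a A) f = sup (f a) (join A f)"
  by (rule order.antisym) (auto simp: join_le_iff intro: join_upper le_supI2)

lemma join_cong: "(\<And>a. a \<in> A \<Longrightarrow> f a = g a) \<Longrightarrow> join A f = join A g"
  unfolding join_def by (metis image_cong)

lemma mult_join: "finite A \<Longrightarrow> x * join A f = join A (\<lambda>a. x * f a)"
  by (induction A rule: finite_induct) (simp_all add: join_insert mult_sup_distrib)

lemma join_mult: "finite A \<Longrightarrow> join A f * x = join A (\<lambda>a. f a * x)"
  by (induction A rule: finite_induct) (simp_all add: join_insert sup_mult_distrib)

lemma join_swap:
  assumes "finite A" "finite B"
  shows "join A (\<lambda>a. join B (\<lambda>b. f a b)) = join B (\<lambda>b. join A (\<lambda>a. f a b))"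
  using assms(1)
proof (induction A rule: finite_induct)
  case empty
  then show ?case
    using assms(2) by (intro order.antisym) (simp_all add: join_le_iff)
next
  case (insert a A)
  have "sup (join B g) (join B h) = join B (\<lambda>b. sup (g b) (h b))" for g h :: "'b \<Rightarrow> 'c"
    using assms(2)
    by (intro order.antisym) (auto simp: join_le_iff
        intro: le_supI1 le_supI2 join_upper intro!: order.trans[OF _ join_upper[OF assms(2)]])
  then show ?case
    using insert by (simp add: join_insert)
qed

lemma join_mono_neutral:
  assumes "finite A" "B \<subseteq> A" "\<And>a. a \<in> A - B \<Longrightarrow> f a = 0"
  shows "join A f = join B f"
proof -
  have "finite B"
    using assms(1,2) by (rule rev_finite_subset)
  moreover have "f a \<le> join B f" if "a \<in> A" for a
    using assms(3)[of a] that join_upper[OF \<open>finite B\<close>] by (cases "a \<in> B") simp_all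
  ultimately show ?thesis
    using assms(1,2) by (intro order.antisym) (auto simp: join_le_iff intro: join_upper)
qed

text \<open>Nonemptiness covers the degenerate case \<open>0 = 1\<close>.\<close>

lemma join_eq_oneD:
  assumes "join A f = 1" "A \<noteq> {}" "\<And>a. a \<in> A \<Longrightarrow> f a = 0 \<or> f a = 1"
  shows "\<exists>a\<in>A. f a = 1"
proof (rule ccontr)
  assume "\<not> ?thesis"
  then have *: "f a = 0" "f a \<noteq> 1" if "a \<in> A" for a
    using assms(3) that by blast+
  then have "insert 0 (f ` A) = {0}"
    by auto
  then have "join A f = 0"
    unfolding join_def by (simp only: Sup_fin.singleton)
  then show False
    using assms(1,2) * by (metis ex_in_conv)
qed

lemma rapp_upper: "finite A \<Longrightarrow> b \<in> A \<Longrightarrow> R a b * f b \<le> rapp A R f a"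
  unfolding rapp_def by (rule join_upper)

lemma rapp_le_iff: "finite A \<Longrightarrow> rapp A R f a \<le> u \<longleftrightarrow> (\<forall>b\<in>A. R a b * f b \<le> u)"
  unfolding rapp_def by (rule join_le_iff)

text \<open>A column of a composition is an application, so results on \<open>rapp\<close> cover
  transition degrees as well as terminal degrees.\<close>

lemma rcomp_eq_rapp: "rcomp A R S a b = rapp A R (\<lambda>c. S c b) a"
  by (simp add: rcomp_def rapp_def)

lemma rapp_crisp:
  assumes "finite A" "equiv A E" "a \<in> A" "\<And>b. (a, b) \<in> E \<Longrightarrow> f b = f a"
  shows "rapp A (crisp E) f a = f a"
proof (rule order.antisym)
  show "rapp A (crisp E) f a \<le> f a"
    using assms by (auto simp: rapp_le_iff crisp_def)
  have "(a, a) \<in> E"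
    using assms(2,3) by (meson equivE refl_onD)
  then show "f a \<le> rapp A (crisp E) f a"
    using rapp_upper[OF assms(1,3), of "crisp E" a f] by (simp add: crisp_def)
qed

lemma join_crisp:
  assumes "finite A" "equiv A E" "a \<in> A" "\<And>b. (a, b) \<in> E \<Longrightarrow> f b = f a"
  shows "join A (\<lambda>b. f b * crisp E b a) = f a"
proof -
  have "f b * crisp E b a = crisp E a b * f b" for b
    using assms(2) by (auto simp: crisp_def elim!: equivE dest: symD)
  then show ?thesis
    using rapp_crisp[where f = f, OF assms] by (simp add: rapp_def)
qed


section \<open>The transitive hull\<close>

lemma warshall:
  fixes R :: "'s \<Rightarrow> 's \<Rightarrow> 'l::integral_l_monoid"
  assumes "finite B" "B \<subseteq> A"
  shows "\<exists>Q. (\<forall>a\<in>A. \<forall>b\<in>A. R a b \<le> Q a b) \<and>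
    (\<forall>a\<in>A. \<forall>b\<in>B. \<forall>c\<in>A. Q a b * Q b c \<le> Q a c) \<and>
    (\<forall>h. (\<forall>a\<in>A. \<forall>b\<in>A. R a b * h b \<le> h a) \<longrightarrow> (\<forall>a\<in>A. \<forall>b\<in>A. Q a b * h b \<le> h a))"
  using assms
proof (induction B rule: finite_induct)
  case empty
  then show ?case
    by (intro exI[of _ R]) auto
next
  case (insert p B)
  then obtain Q where
    QR: "\<And>a b. a \<in> A \<Longrightarrow> b \<in> A \<Longrightarrow> R a b \<le> Q a b" and
    QT: "\<And>a b c. a \<in> A \<Longrightarrow> b \<in> B \<Longrightarrow> c \<in> A \<Longrightarrow> Q a b * Q b c \<le> Q a c" and
    QL: "\<And>h a b. (\<forall>a\<in>A. \<forall>b\<in>A. R a b * h b \<le> h a) \<Longrightarrow> a \<in> A \<Longrightarrow> b \<in> A \<Longrightarrow> Q a b * h b \<le> h a"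
    by (metis insert_subset)
  have pA: "p \<in> A" and BA: "B \<subseteq> A"
    using insert.prems by auto
  \<comment> \<open>Warshall's update for the new intermediate state \<open>p\<close>. A single
    passage through \<open>p\<close> is enough, because \<open>Q p p\<close> is at most 1.\<close>
  define Q' where "Q' a b = sup (Q a b) (Q a p * Q p b)" for a b
  have le: "Q a b \<le> Q' a b" "Q a p * Q p b \<le> Q' a b" for a b
    by (simp_all add: Q'_def)
  have toP: "Q' a p = Q a p" "Q' p a = Q p a" for a
    by (simp_all add: Q'_def sup_absorb1 l_mult_le)
  have "Q' a b * Q' b c \<le> Q' a c" if "a \<in> A" "b \<in> B" "c \<in> A" for a b c
  proof -
    have 1: "Q a b * Q b c \<le> Q' a c"
      using QT[OF that] le(1) by (rule order.trans)
    have 2: "Q a b * (Q b p * Q p c) \<le> Q' a c"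
      using l_mult_mono[OF QT[OF that(1,2) pA] order.refl[of "Q p c"]] le(2)[of a c]
      by (simp add: mult.assoc)
    have 3: "Q a p * Q p b * Q b c \<le> Q' a c"
      using l_mult_mono[OF order.refl[of "Q a p"] QT[OF pA that(2,3)]] le(2)[of a c]
      by (simp add: mult.assoc)
    have "Q a p * Q p b * (Q b p * Q p c) \<le> Q a p * Q p c"
      by (intro l_mult_mono l_mult_le)
    then have 4: "Q a p * Q p b * (Q b p * Q p c) \<le> Q' a c"
      using le(2) by (rule order.trans)
    show ?thesis
      using 1 2 3 4 by (simp add: Q'_def[of a b] Q'_def[of b c] mult_sup_distrib sup_mult_distrib)
  qed
  moreover have "Q' a p * Q' p c \<le> Q' a c" for a c
    by (simp add: toP le)
  moreover have "Q' a b * h b \<le> h a"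
    if h: "\<forall>a\<in>A. \<forall>b\<in>A. R a b * h b \<le> h a" and ab: "a \<in> A" "b \<in> A" for h a b
  proof -
    have "Q a p * (Q p b * h b) \<le> Q a p * h p"
      by (intro l_mult_mono order.refl QL[OF h pA ab(2)])
    also have "\<dots> \<le> h a"
      by (rule QL[OF h ab(1) pA])
    finally show ?thesis
      using QL[OF h ab] by (simp add: Q'_def sup_mult_distrib mult.assoc)
  qed
  moreover have "R a b \<le> Q' a b" if "a \<in> A" "b \<in> A" for a b
    using QR[OF that] le(1) by (rule order.trans)
  ultimately show ?case
    by (intro exI[of _ Q']) auto
qed

lemma transitive_hull:
  fixes R :: "'s \<Rightarrow> 's \<Rightarrow> 'l::integral_l_monoid"
  assumes A: "finite A" and refl: "\<And>a. a \<in> A \<Longrightarrow> R a a = 1"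
  shows transitive_hull_trans: "transitive_frel A (transitive_hull A R)"
    and transitive_hull_ge: "\<And>a b. a \<in> A \<Longrightarrow> b \<in> A \<Longrightarrow> R a b \<le> transitive_hull A R a b"
    and transitive_hull_closed: "\<And>h a b. (\<And>c d. c \<in> A \<Longrightarrow> d \<in> A \<Longrightarrow> R c d * h d \<le> h c) \<Longrightarrow>
      a \<in> A \<Longrightarrow> b \<in> A \<Longrightarrow> transitive_hull A R a b * h b \<le> h a"
proof -
  from warshall[OF A order.refl, of R] obtain Q where
    QR: "\<And>a b. a \<in> A \<Longrightarrow> b \<in> A \<Longrightarrow> R a b \<le> Q a b" and
    QT: "\<And>a b c. a \<in> A \<Longrightarrow> b \<in> A \<Longrightarrow> c \<in> A \<Longrightarrow> Q a b * Q b c \<le> Q a c" and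
    QL: "\<And>h. (\<forall>a\<in>A. \<forall>b\<in>A. R a b * h b \<le> h a) \<longrightarrow> (\<forall>a\<in>A. \<forall>b\<in>A. Q a b * h b \<le> h a)"
    by blast
  \<comment> \<open>Total functions are compared pointwise, so the least one must be 0 off
    \<open>A\<close>.\<close>
  define P where "P a b = (if a \<in> A \<and> b \<in> A then Q a b else 0)" for a b
  have hull: "transitive_hull A R = P"
    unfolding transitive_hull_def
  proof (rule Least_equality)
    show "transitive_frel A P \<and> (\<forall>a\<in>A. \<forall>b\<in>A. R a b \<le> P a b)"
      using QR QT by (simp add: transitive_frel_def P_def)
  next
    fix T assume T: "transitive_frel A T \<and> (\<forall>a\<in>A. \<forall>b\<in>A. R a b \<le> T a b)"
    have "Q a b \<le> T a b" if ab: "a \<in> A" "b \<in> A" for a b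
    proof -
      have "R c d * T d b \<le> T c b" if "c \<in> A" "d \<in> A" for c d
      proof -
        have "R c d * T d b \<le> T c d * T d b"
          using T that by (intro l_mult_mono) auto
        also have "\<dots> \<le> T c b"
          using T that ab by (auto simp: transitive_frel_def)
        finally show ?thesis .
      qed
      \<comment> \<open>Here \<open>h\<close> is the column of \<open>T\<close> at \<open>b\<close>.
        Since \<open>T\<close> contains the reflexive \<open>R\<close>, the factor
        \<open>T b b\<close> is 1 and disappears.\<close>
      then have "Q a b * T b b \<le> T a b"
        using QL[of "\<lambda>c. T c b"] ab by blast
      moreover have "T b b = 1"
        using T ab refl[of b] by (intro order.antisym one_greatest) metis
      ultimately show ?thesis
        by simp
    qed
    then show "P \<le> T"
      by (auto simp: P_def le_fun_def)
  qed
  show "transitive_frel A (transitive_hull A R)"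
    using QT by (simp add: hull transitive_frel_def P_def)
  show "R a b \<le> transitive_hull A R a b" if "a \<in> A" "b \<in> A" for a b
    using QR that by (simp add: hull P_def)
  show "transitive_hull A R a b * h b \<le> h a"
    if "\<And>c d. c \<in> A \<Longrightarrow> d \<in> A \<Longrightarrow> R c d * h d \<le> h c" "a \<in> A" "b \<in> A" for h a b
    using QL[of h] that by (simp add: hull P_def)
qed

text \<open>The first claim rests on reflexivity, the second on transitivity of the hull, the third
  on \<open>transitive_hull_closed\<close>. Later arguments use these three facts and never unfold
  the hull.\<close>

lemma rapp_hull:
  fixes R :: "'s \<Rightarrow> 's \<Rightarrow> 'l::integral_l_monoid"
  assumes A: "finite A" and refl: "\<And>a. a \<in> A \<Longrightarrow> R a a = 1"
  shows rapp_hull_ge: "\<And>a. a \<in> A \<Longrightarrow> f a \<le> rapp A (transitive_hull A R) f a"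
    and rapp_hull_closed: "\<And>a b. a \<in> A \<Longrightarrow> b \<in> A \<Longrightarrow>
      R a b * rapp A (transitive_hull A R) f b \<le> rapp A (transitive_hull A R) f a"
    and rapp_hull_least: "\<And>h a. (\<And>c d. c \<in> A \<Longrightarrow> d \<in> A \<Longrightarrow> R c d * h d \<le> h c) \<Longrightarrow>
      (\<And>c. c \<in> A \<Longrightarrow> f c \<le> h c) \<Longrightarrow> a \<in> A \<Longrightarrow> rapp A (transitive_hull A R) f a \<le> h a"
proof -
  let ?Q = "transitive_hull A R"
  have trans: "transitive_frel A ?Q"
    by (rule transitive_hull_trans[OF A refl])
  have ge: "R a b \<le> ?Q a b" if "a \<in> A" "b \<in> A" for a b
    using A refl that by (rule transitive_hull_ge)
  show "f a \<le> rapp A ?Q f a" if "a \<in> A" for a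
  proof -
    have "?Q a a = 1"
      using ge[OF that that] refl[OF that] by (intro order.antisym one_greatest) metis
    then show ?thesis
      using rapp_upper[OF A that, of ?Q a f] by simp
  qed
  show "R a b * rapp A ?Q f b \<le> rapp A ?Q f a" if "a \<in> A" "b \<in> A" for a b
  proof -
    have "R a b * (?Q b c * f c) \<le> rapp A ?Q f a" if c: "c \<in> A" for c
    proof -
      have "R a b * ?Q b c \<le> ?Q a b * ?Q b c"
        using ge \<open>a \<in> A\<close> \<open>b \<in> A\<close> by (intro l_mult_mono) auto
      also have "\<dots> \<le> ?Q a c"
        using trans \<open>a \<in> A\<close> \<open>b \<in> A\<close> c by (auto simp: transitive_frel_def)
      finally have "R a b * ?Q b c * f c \<le> ?Q a c * f c"
        by (intro l_mult_mono) auto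
      also have "\<dots> \<le> rapp A ?Q f a"
        by (rule rapp_upper[OF A c])
      finally show ?thesis
        by (simp add: mult.assoc)
    qed
    then show ?thesis
      using A by (simp add: rapp_def[of A ?Q f b] mult_join join_le_iff)
  qed
  show "rapp A ?Q f a \<le> h a"
    if h: "\<And>c d. c \<in> A \<Longrightarrow> d \<in> A \<Longrightarrow> R c d * h d \<le> h c" "\<And>c. c \<in> A \<Longrightarrow> f c \<le> h c"
      and a: "a \<in> A" for h a
  proof -
    have "?Q a b * f b \<le> h a" if b: "b \<in> A" for b
    proof -
      have "?Q a b * f b \<le> ?Q a b * h b"
        using h(2) b by (intro l_mult_mono) auto
      also have "\<dots> \<le> h a"
        using A refl h(1) a b by (rule transitive_hull_closed)
      finally show ?thesis .
    qed
    then show ?thesis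
      using A by (simp add: rapp_le_iff)
  qed
qed


section \<open>Reduction commutes with factorization\<close>

text \<open>Equal rows are stronger than right invariance: composing with \<open>E\<close> on the
  left leaves the transition degrees between states unchanged, instead of satisfying a mere
  inequality.\<close>

locale row_equivalence =
  fixes M :: "('s, 'z, 'l::integral_l_monoid) fuzzy_automaton"
    and E :: "('s \<times> 's) set"
  assumes finite_states: "finite (states M)"
    and init_state: "init M \<in> states M"
    and crisp_tdeg: "tdeg M a x b = 0 \<or> tdeg M a x b = 1"
    and equiv_E: "equiv (states M) E"
    and tdeg_row: "(a, b) \<in> E \<Longrightarrow> tdeg M a x c = tdeg M b x c"
    and final_row: "(a, b) \<in> E \<Longrightarrow> final M a = final M b"
begin

section \<open>Transitions of the factor automaton\<close>

abbreviation "A \<equiv> states M"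
abbreviation "cls a \<equiv> E `` {a}"
abbreviation "N \<equiv> factor M E"

lemma E_states: "(a, b) \<in> E \<Longrightarrow> a \<in> A" "(a, b) \<in> E \<Longrightarrow> b \<in> A"
  using equiv_E equiv_type by blast+

lemma E_refl: "a \<in> A \<Longrightarrow> (a, a) \<in> E"
  using equiv_E by (meson equivE refl_onD)

lemma E_sym: "(a, b) \<in> E \<Longrightarrow> (b, a) \<in> E"
  using equiv_E by (meson equivE symD)

lemma cls_eq_iff: "a \<in> A \<Longrightarrow> b \<in> A \<Longrightarrow> cls a = cls b \<longleftrightarrow> (a, b) \<in> E"
  using equiv_E by (simp add: eq_equiv_class_iff)

lemma states_factor: "states N = cls ` A"
  by (auto simp: factor_def quotient_def)

lemma finite_factor: "finite (states N)"
  by (simp add: states_factor finite_states)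

text \<open>Row equality absorbs the left factor \<open>E\<close> of the defining composition, so
  only the join over representatives of the target class remains.\<close>

lemma tdeg_cls:
  assumes "a \<in> A" "b \<in> A"
  shows "tdeg N (cls a) x (cls b) = join A (\<lambda>c. tdeg M a x c * crisp E c b)"
proof -
  have "rcomp A (crisp E) (\<lambda>c d. tdeg M c x d) a c = tdeg M a x c" for c
    unfolding rcomp_eq_rapp using finite_states equiv_E assms(1)
    by (rule rapp_crisp) (metis tdeg_row)
  then show ?thesis
    by (simp add: tdeg_factor[OF equiv_E assms] rcomp_def[of A "rcomp _ _ _"])
qed

lemma final_cls: "a \<in> A \<Longrightarrow> final N (cls a) = final M a"
  using join_crisp[OF finite_states equiv_E, of a "final M"]
  by (simp add: final_factor[OF equiv_E]) (metis final_row)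

lemma tdeg_le_factor:
  assumes "a \<in> A" "b \<in> A"
  shows "tdeg M a x b \<le> tdeg N (cls a) x (cls b)"
  using join_upper[OF finite_states assms(2), of "\<lambda>c. tdeg M a x c * crisp E c b"] E_refl[OF assms(2)]
  by (simp add: tdeg_cls[OF assms]) (simp add: crisp_def)

text \<open>States of a reduced automaton are selected by degree exactly 1, so an edge of degree 1
  between classes has to be traced back to one in \<open>M\<close>.\<close>

lemma tdeg_cls_eq_one_iff:
  assumes "a \<in> A" "b \<in> A"
  shows "tdeg N (cls a) x (cls b) = 1 \<longleftrightarrow> (\<exists>c. (c, b) \<in> E \<and> tdeg M a x c = 1)"
proof
  assume "tdeg N (cls a) x (cls b) = 1"
  then have "\<exists>c\<in>A. tdeg M a x c * crisp E c b = 1"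
    unfolding tdeg_cls[OF assms]
    by (rule join_eq_oneD) (use assms crisp_tdeg in \<open>auto simp: crisp_def\<close>)
  then obtain c where c: "c \<in> A" "tdeg M a x c * crisp E c b = 1"
    by blast
  show "\<exists>c. (c, b) \<in> E \<and> tdeg M a x c = 1"
  proof (cases "(c, b) \<in> E")
    case True
    then show ?thesis
      using c by (auto simp: crisp_def)
  next
    \<comment> \<open>The product is now 0, so this case forces 0 = 1. Every degree of
      \<open>M\<close> then equals 1, and \<open>b\<close> itself is a witness.\<close>
    case False
    then have "(0::'l) = 1"
      using c by (simp add: crisp_def)
    then have "tdeg M a x b = 1"
      using crisp_tdeg by metis
    then show ?thesis
      using E_refl[OF assms(2)] by blast
  qed
next
  assume "\<exists>c. (c, b) \<in> E \<and> tdeg M a x c = 1"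
  then obtain c where c: "(c, b) \<in> E" "tdeg M a x c = 1"
    by blast
  have "cls c = cls b"
    using c(1) cls_eq_iff E_states by blast
  then have "1 \<le> tdeg N (cls a) x (cls b)"
    using tdeg_le_factor[OF assms(1) E_states(1)[OF c(1)], of x] c(2) by simp
  then show "tdeg N (cls a) x (cls b) = 1"
    by (simp add: order.antisym)
qed

section \<open>Closure under scalar transitions and its descent to the factor\<close>

context
  fixes K :: "'l set" and pr :: "'l \<Rightarrow> 'z"
  assumes finite_K: "finite K"
begin

abbreviation "hullapp f \<equiv> rapp A (scalar_hull K pr M) f"
abbreviation "frel \<equiv> scalar_frel K pr M"

lemma scalar_frel_refl: "scalar_frel K pr M' a a = 1"
  by (simp add: scalar_frel_def)

lemmas hullapp = rapp_hull[where R = frel, OF finite_states scalar_frel_refl,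
    folded scalar_hull_def]
lemmas hullapp_ge = hullapp(1) and hullapp_closed = hullapp(2) and hullapp_least = hullapp(3)

lemmas hullapp_factor = rapp_hull[where R = "scalar_frel K pr N", OF finite_factor scalar_frel_refl,
    folded scalar_hull_def]

text \<open>Replacing the value of \<open>R\<^sub>\<A> \<circ> f\<close> at \<open>a\<close> by its meet with the value at \<open>b\<close> leaves a
  function to which the leastness of \<open>R\<^sub>\<A> \<circ> f\<close> applies.\<close>

lemma hullapp_row_le:
  assumes ab: "(a, b) \<in> E" and f: "f a = f b"
  shows "hullapp f a \<le> hullapp f b"
proof -
  let ?H = "hullapp f"
  note A = E_states[OF ab]
  define h where "h c = (if c = a then inf (?H a) (?H b) else ?H c)" for c
  have hH: "h c \<le> ?H c" for c
    by (simp add: h_def)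
  have "?H a \<le> h a"
  proof (rule hullapp_least)
    fix c d assume cd: "c \<in> A" "d \<in> A"
    have "frel c d * h d \<le> frel c d * ?H d"
      by (intro l_mult_mono hH order.refl)
    also have "\<dots> \<le> ?H c"
      using cd by (rule hullapp_closed)
    finally have 1: "frel c d * h d \<le> ?H c" .
    \<comment> \<open>Off the diagonal the row of \<open>a\<close> is bounded by that of
      \<open>b\<close>. At \<open>d = a\<close> the entry is 1 whereas that of \<open>b\<close> may
      be smaller; there the meet in \<open>h a\<close> gives the bound.\<close>
    have "frel a d * h d \<le> ?H b"
    proof (cases "d = a")
      case True
      then show ?thesis
        by (simp add: scalar_frel_def h_def)
    next
      case False
      have "frel a d \<le> frel b d"
        using False by (simp add: scalar_frel_def tdeg_row[OF ab])
      then have "frel a d * h d \<le> frel b d * ?H d"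
        by (intro l_mult_mono hH)
      also have "\<dots> \<le> ?H b"
        using A(2) cd(2) by (rule hullapp_closed)
      finally show ?thesis .
    qed
    then show "frel c d * h d \<le> h c"
      using 1 by (auto simp: h_def[of c])
  next
    fix c assume "c \<in> A"
    then show "f c \<le> h c"
      using hullapp_ge[of c f] hullapp_ge[OF A(2), of f] f by (auto simp: h_def)
  qed (rule A)
  then show ?thesis
    by (simp add: h_def)
qed

lemma hullapp_row: "(a, b) \<in> E \<Longrightarrow> f a = f b \<Longrightarrow> hullapp f a = hullapp f b"
  by (intro order.antisym hullapp_row_le) (simp_all add: E_sym)

text \<open>If the two classes coincide, the right-hand side is 1; otherwise the joins over scalars
  are compared term by term.\<close>

lemma frel_le_factor: "a \<in> A \<Longrightarrow> b \<in> A \<Longrightarrow> frel a b \<le> scalar_frel K pr N (cls a) (cls b)"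
  unfolding scalar_frel_def using finite_K
  by (auto simp: join_le_iff tdeg_le_factor
      intro!: order.trans[OF _ join_upper[OF finite_K]] l_mult_mono)

text \<open>Both inequalities use leastness. Pulled back along \<open>cls\<close>, the closure of
  \<open>g\<close> is closed under \<open>frel\<close>; conversely the closure of \<open>f\<close>
  is constant on classes, and its descent is closed under the scalar relation of the factor.\<close>

lemma hullapp_cls:
  assumes row: "\<And>a b. (a, b) \<in> E \<Longrightarrow> f a = f b"
    and g: "\<And>a. a \<in> A \<Longrightarrow> g (cls a) = f a"
    and a: "a \<in> A"
  shows "rapp (states N) (scalar_hull K pr N) g (cls a) = hullapp f a"
proof (rule order.antisym)
  let ?G = "rapp (states N) (scalar_hull K pr N) g"
  let ?H = "hullapp f"
  have H_row: "?H c = ?H d" if "(c, d) \<in> E" for c d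
    using that row by (intro hullapp_row) auto
  show "?H a \<le> ?G (cls a)"
  proof (rule hullapp_least[where h = "\<lambda>c. ?G (cls c)"])
    fix c d assume cd: "c \<in> A" "d \<in> A"
    have "frel c d * ?G (cls d) \<le> scalar_frel K pr N (cls c) (cls d) * ?G (cls d)"
      by (intro l_mult_mono frel_le_factor cd order.refl)
    also have "\<dots> \<le> ?G (cls c)"
      using cd by (intro hullapp_factor(2)) (auto simp: states_factor)
    finally show "frel c d * ?G (cls d) \<le> ?G (cls c)" .
  next
    fix c assume "c \<in> A"
    then show "f c \<le> ?G (cls c)"
      using hullapp_factor(1)[of "cls c" g] g by (simp add: states_factor)
  qed (rule a)
  \<comment> \<open>The descent of \<open>?H\<close> to classes; \<open>H_row\<close> makes each
    image a singleton.\<close>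
  define h where "h P = the_elem (?H ` P)" for P
  have h: "h (cls c) = ?H c" if "c \<in> A" for c
    unfolding h_def using that E_refl H_row by (intro the_elem_const_image) auto
  have "?G (cls a) \<le> h (cls a)"
  proof (rule hullapp_factor(3))
    fix P Q assume "P \<in> states N" "Q \<in> states N"
    then obtain c d where cd: "c \<in> A" "P = cls c" "d \<in> A" "Q = cls d"
      by (auto simp: states_factor)
    have "scalar_frel K pr N P Q * ?H d \<le> ?H c"
    proof (cases "P = Q")
      case True
      then show ?thesis
        using cd cls_eq_iff H_row by (auto simp: scalar_frel_def)
    next
      case False
      \<comment> \<open>A scalar edge between classes is a join of edges from \<open>c\<close> to
        representatives \<open>e\<close> of the target, and \<open>?H e = ?H d\<close>. As the
        classes differ, \<open>c\<close> and \<open>e\<close> differ, so \<open>frel c e\<close> is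
        the join over scalars.\<close>
      have "l * (tdeg M c (pr l) e * crisp E e d) * ?H d \<le> ?H c"
        if l: "l \<in> K" and e: "e \<in> A" for l e
      proof (cases "(e, d) \<in> E")
        case True
        then have "c \<noteq> e"
          using False cd cls_eq_iff by auto
        then have "l * tdeg M c (pr l) e \<le> frel c e"
          using join_upper[OF finite_K l, of "\<lambda>l. l * tdeg M c (pr l) e"]
          by (simp add: scalar_frel_def)
        then have "l * tdeg M c (pr l) e * ?H e \<le> frel c e * ?H e"
          by (intro l_mult_mono order.refl)
        also have "\<dots> \<le> ?H c"
          using cd(1) e by (rule hullapp_closed)
        finally show ?thesis
          using True H_row[OF True] by (simp add: crisp_def)
      qed (simp add: crisp_def)
      then show ?thesis
        using False cd(1,3) finite_K finite_states
        unfolding cd(2,4)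
        by (simp add: scalar_frel_def tdeg_cls mult_join join_mult join_le_iff)
    qed
    then show "scalar_frel K pr N P Q * h Q \<le> h P"
      by (simp add: cd h)
  next
    fix P assume "P \<in> states N"
    then show "g P \<le> h P"
      using hullapp_ge[of _ f] by (auto simp: states_factor g h)
  qed (simp add: states_factor a)
  then show "?G (cls a) \<le> ?H a"
    by (simp add: h a)
qed

section \<open>Comparison of the two reduced automata\<close>

context
  fixes X :: "'z set"
begin

abbreviation "MR \<equiv> reduced X K pr M"
abbreviation "B \<equiv> states MR"
abbreviation "F \<equiv> E \<inter> B \<times> B"

lemma reduced_sel:
  "alphabet (reduced X K pr M') = X"
  "init (reduced X K pr M') = init M'"
  "tdeg (reduced X K pr M') a x b =
    rapp (states M') (scalar_hull K pr M') (\<lambda>c. tdeg M' c x b) a"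
  "final (reduced X K pr M') a = rapp (states M') (scalar_hull K pr M') (final M') a"
  "states (reduced X K pr M') =
    insert (init M') {a \<in> states M'. \<exists>b\<in>states M'. \<exists>x\<in>X. tdeg M' b x a = 1}"
  by (auto simp: reduced_def rcomp_eq_rapp)

lemma B_subset: "B \<subseteq> A"
  using init_state by (auto simp: reduced_sel)

lemma finite_B: "finite B"
  using B_subset finite_states by (rule finite_subset)

lemma equiv_F: "equiv B F"
  using equiv_E B_subset unfolding equiv_def refl_on_def sym_on_def trans_on_def by blast

lemma tdeg_MR_row: "(a, b) \<in> E \<Longrightarrow> tdeg MR a x c = tdeg MR b x c"
  unfolding reduced_sel by (intro hullapp_row) (simp_all add: tdeg_row)

lemma final_MR_row: "(a, b) \<in> E \<Longrightarrow> final MR a = final MR b"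
  unfolding reduced_sel by (intro hullapp_row) (simp_all add: final_row)

lemma F_comp_tdeg: "a \<in> B \<Longrightarrow> rcomp B (crisp F) (\<lambda>c d. tdeg MR c x d) a b = tdeg MR a x b"
  unfolding rcomp_eq_rapp using finite_B equiv_F
  by (rule rapp_crisp) (auto intro: tdeg_MR_row E_sym)

text \<open>Rows of \<open>MR\<close> agree on classes of \<open>F\<close>, so the left-hand
  composition is just the transition degree, which reflexivity of \<open>F\<close> bounds by the
  right-hand one.\<close>

lemma right_invariant_F: "right_invariant MR F"
  unfolding right_invariant_def
proof (intro conjI ballI)
  fix x a b assume "a \<in> B" "b \<in> B"
  then have "(b, b) \<in> F"
    using equiv_F by (meson equivE refl_onD)
  then show "rcomp B (crisp F) (\<lambda>c d. tdeg MR c x d) a b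
      \<le> rcomp B (\<lambda>c d. tdeg MR c x d) (crisp F) a b"
    using join_upper[OF finite_B \<open>b \<in> B\<close>, of "\<lambda>c. tdeg MR a x c * crisp F c b"]
    by (simp add: F_comp_tdeg \<open>a \<in> B\<close>) (simp add: rcomp_def crisp_def)
next
  fix a assume "a \<in> B"
  with finite_B equiv_F show "rapp B (crisp F) (final MR) a = final MR a"
    by (rule rapp_crisp) (auto intro: final_MR_row E_sym)
qed (rule equiv_F)

text \<open>No letter of \<open>X\<close> leads to such a \<open>b\<close> with degree 1, hence by
  crispness all those degrees are 0. This lets joins over \<open>B\<close> be extended to
  \<open>A\<close>.\<close>

lemma tdeg_MR_outside:
  assumes "x \<in> X" "b \<in> A - B"
  shows "tdeg MR a x b = 0"
proof -
  have "tdeg M c x b = 0" if "c \<in> A" for c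
    using assms that crisp_tdeg[of c x b] by (auto simp: reduced_sel)
  then have "hullapp (\<lambda>c. tdeg M c x b) a \<le> 0"
    by (simp add: rapp_le_iff finite_states)
  then show ?thesis
    by (simp add: reduced_sel order.antisym)
qed

lemma tdeg_factor_MR:
  assumes a: "a \<in> B" and b: "b \<in> B" and x: "x \<in> X"
  shows "tdeg (factor MR F) (F `` {a}) x (F `` {b}) = tdeg (reduced X K pr N) (cls a) x (cls b)"
proof -
  have ab: "a \<in> A" "b \<in> A"
    using a b B_subset by auto
  \<comment> \<open>\<open>g\<close> is the column of the factor's transition degrees at
    \<open>cls b\<close>, read on representatives. It is constant on classes, as
    \<open>hullapp_cls\<close> requires.\<close>
  define g where "g c = join A (\<lambda>d. tdeg M c x d * crisp E d b)" for c
  have "tdeg (factor MR F) (F `` {a}) x (F `` {b}) = join B (\<lambda>d. tdeg MR a x d * crisp F d b)"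
    using a by (simp add: tdeg_factor[OF equiv_F a b] rcomp_def[of B "rcomp _ _ _"] F_comp_tdeg)
  also have "\<dots> = join B (\<lambda>d. tdeg MR a x d * crisp E d b)"
    using b by (intro join_cong) (simp add: crisp_def)
  also have "\<dots> = join A (\<lambda>d. tdeg MR a x d * crisp E d b)"
    using finite_states B_subset tdeg_MR_outside[OF x]
    by (intro join_mono_neutral[symmetric]) simp_all
  also have "\<dots> = join A (\<lambda>d. join A (\<lambda>c. scalar_hull K pr M a c * (tdeg M c x d * crisp E d b)))"
    by (simp add: reduced_sel rapp_def join_mult finite_states mult.assoc)
  also have "\<dots> = hullapp g a"
    by (subst join_swap) (simp_all add: finite_states rapp_def g_def mult_join)
  also have "\<dots> = tdeg (reduced X K pr N) (cls a) x (cls b)"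
    unfolding reduced_sel
    by (rule hullapp_cls[symmetric]) (simp_all add: g_def tdeg_row tdeg_cls ab)
  finally show ?thesis .
qed

lemma final_factor_MR:
  assumes a: "a \<in> B"
  shows "final (factor MR F) (F `` {a}) = final (reduced X K pr N) (cls a)"
proof -
  have "final (factor MR F) (F `` {a}) = final MR a"
    unfolding final_factor[OF equiv_F a] using finite_B equiv_F a
    by (rule join_crisp) (auto intro: final_MR_row E_sym)
  also have "\<dots> = hullapp (final M) a"
    by (simp add: reduced_sel)
  also have "\<dots> = final (reduced X K pr N) (cls a)"
    unfolding reduced_sel
    by (rule hullapp_cls[symmetric]) (use a B_subset in \<open>auto simp: final_row final_cls\<close>)
  finally show ?thesis .
qed

text \<open>An edge of degree 1 into a class comes from one into some member \<open>c\<close>,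
  perhaps not the chosen representative. That \<open>c\<close> lies in \<open>B\<close> and names
  the same class.\<close>

lemma states_reduced_factor: "states (reduced X K pr N) = cls ` B"
proof (intro equalityI subsetI)
  fix P assume P: "P \<in> states (reduced X K pr N)"
  show "P \<in> cls ` B"
  proof (cases "P = cls (init M)")
    case True
    then show ?thesis
      by (simp add: reduced_sel)
  next
    case False
    then obtain a b x where *: "a \<in> A" "b \<in> A" "P = cls a" "x \<in> X" "tdeg N (cls b) x (cls a) = 1"
      using P by (auto simp: reduced_sel states_factor) (auto simp: factor_def)
    then obtain c where c: "(c, a) \<in> E" "tdeg M b x c = 1"
      using tdeg_cls_eq_one_iff by blast
    then have "c \<in> B"
      using * E_states by (auto simp: reduced_sel)
    moreover have "P = cls c"
      using * c cls_eq_iff E_states by blast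
    ultimately show ?thesis
      by blast
  qed
next
  fix P assume "P \<in> cls ` B"
  then obtain a where a: "a \<in> B" "P = cls a"
    by blast
  show "P \<in> states (reduced X K pr N)"
  proof (cases "a = init M")
    case True
    then show ?thesis
      using a by (simp add: reduced_sel factor_def)
  next
    case False
    then obtain b x where *: "a \<in> A" "b \<in> A" "x \<in> X" "tdeg M b x a = 1"
      using a by (auto simp: reduced_sel)
    then have "tdeg N (cls b) x (cls a) = 1"
      using tdeg_cls_eq_one_iff E_refl by blast
    then show ?thesis
      using * a by (auto simp: reduced_sel states_factor)
  qed
qed

lemma cls_Int_B: "a \<in> B \<Longrightarrow> cls a \<inter> B = F `` {a}"
  by auto

lemma isomorphic_reduced_factor: "isomorphic (reduced X K pr N) (factor MR F)"
  unfolding isomorphic_def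
proof (intro conjI exI[of _ "\<lambda>P. P \<inter> B"] ballI)
  have init_B: "init M \<in> B"
    by (simp add: reduced_sel)
  show "alphabet (reduced X K pr N) = alphabet (factor MR F)"
    by (simp add: reduced_sel factor_def)
  have "inj_on (\<lambda>P. P \<inter> B) (cls ` B)"
  proof (rule inj_onI)
    fix P Q assume "P \<in> cls ` B" "Q \<in> cls ` B" and eq: "P \<inter> B = Q \<inter> B"
    then obtain a b where ab: "a \<in> B" "P = cls a" "b \<in> B" "Q = cls b"
      by blast
    then have "b \<in> cls a"
      using eq E_refl[of b] B_subset by blast
    then show "P = Q"
      using ab cls_eq_iff E_states by blast
  qed
  moreover have "(\<lambda>P. P \<inter> B) ` cls ` B = states (factor MR F)"
    unfolding image_image by (auto simp: factor_def quotient_def cls_Int_B)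
  ultimately show "bij_betw (\<lambda>P. P \<inter> B) (states (reduced X K pr N)) (states (factor MR F))"
    by (simp add: bij_betw_def states_reduced_factor)
  have "init (reduced X K pr N) = cls (init M)" "init (factor MR F) = F `` {init M}"
    by (simp_all add: reduced_sel(2) factor_def)
  then show "init (reduced X K pr N) \<inter> B = init (factor MR F)"
    by (simp only: cls_Int_B[OF init_B])
next
  fix P Q x
  assume "P \<in> states (reduced X K pr N)" "Q \<in> states (reduced X K pr N)"
    "x \<in> alphabet (reduced X K pr N)"
  then obtain a b where "a \<in> B" "P = cls a" "b \<in> B" "Q = cls b" "x \<in> X"
    unfolding states_reduced_factor reduced_sel(1) by blast
  then show "tdeg (factor MR F) (P \<inter> B) x (Q \<inter> B) = tdeg (reduced X K pr N) P x Q"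
    by (simp only: cls_Int_B tdeg_factor_MR)
next
  fix P
  assume "P \<in> states (reduced X K pr N)"
  then obtain a where "a \<in> B" "P = cls a"
    unfolding states_reduced_factor by blast
  then show "final (factor MR F) (P \<inter> B) = final (reduced X K pr N) P"
    by (simp only: cls_Int_B final_factor_MR)
qed

end

end

end

section \<open>Application to the position automaton\<close>

lemma finite_scalars: "finite (scalars \<alpha>)"
  by (induction \<alpha>) simp_all

text \<open>The letter of a transition is fixed by its target position, so the source enters only
  through its follow set. Follow-equivalent positions therefore have equal rows.\<close>

lemma row_equivalence_follow:
  "row_equivalence (position_automaton Z \<beta>) (follow_equiv \<beta>)"
proof
  show "equiv (states (position_automaton Z \<beta>)) (follow_equiv \<beta>)"
    by (auto simp: position_automaton_def follow_equiv_def intro!: equivI refl_onI symI transI)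
qed (auto simp: position_automaton_def follow_equiv_def pos0_def)

theorem theorem6p6:
  fixes \<alpha> :: "('l::integral_l_monoid, 'x) fregexp"
    and X Y :: "'x set"
    and pr :: "'l \<Rightarrow> 'x"
  assumes "finite X"
    and "letters \<alpha> \<subseteq> X"
    and "associated_alphabet X \<alpha> Y pr"
  shows "\<exists>F. right_invariant (position_fuzzy_automaton X Y pr \<alpha>) F \<and>
    isomorphic (follow_fuzzy_automaton X Y pr \<alpha>) (factor (position_fuzzy_automaton X Y pr \<alpha>) F)"
proof -
  interpret row_equivalence
    "position_automaton (X \<union> Y) (to_regexp pr \<alpha>) :: (nat, 'x, 'l) fuzzy_automaton"
    "follow_equiv (to_regexp pr \<alpha>)"
    by (rule row_equivalence_follow)
  show ?thesis
    unfolding position_fuzzy_automaton_def follow_fuzzy_automaton_def follow_automaton_def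
    using right_invariant_F[OF finite_scalars] isomorphic_reduced_factor[OF finite_scalars] by blast
qed

end
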